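(* There exists an absolute constant $c>0$ such that the following holds. Let $d=2$, let $\epsilon\in(0,1)$ and put $\epsilon'=\epsilon/c$. Let $k$ and $l$ be positive integers with $$k> d-1+2\cdot 8^{\frac{2}{l}}\frac{(6l)^{1+\frac{1}{l}}}{\epsilon'^2}\qquad\text{and}\qquad l\ge 3d+2 .$$ Then every $l$-wise independent family of hash functions $\mathcal{H}\subseteq [u]\to[u]$ is approximately $d$-$k$-min-wise independent with error bound $\epsilon$.
   Context: Let $[u]=\{0,\dots,u-1\}$. A family $\mathcal{H}$ of functions $[u]\to[u]$ is $l$-wise independent if, for $h$ chosen uniformly at random from $\mathcal{H}$, for any $l$ distinct $x_1,\dots,x_l\in[u]$ and any $v_1,\dots,v_l\in[u]$, $\Pr[h(x_1)=v_1,\dots,h(x_l)=v_l]=u^{-l}$. For a finite set $S$ of numbers, $RANK_j(S)$ denotes the $j$-th smallest element of $S$; for a function $h$ and a set $X$, $h(X)=\{h(x):x\in X\}$. A family $\mathcal{H}$ of functions $[u]\to[u]$ is called approximately $d$-$k$-min-wise independent with error bound $\epsilon\in(0,1)$ if for every $n$, every $X\subseteq[u]$ with $|X|=n-d$ and every $Y\subseteq[u]$ with $|Y|=d$ and $X\cap Y=\emptyset$ (with $d\le k$), we have $$\Pr_{h\in\mathcal{H}}\left[RANK_d(h(Y))<RANK_{k-d+1}(h(X))\right]=\frac{\binom{k}{d}}{\binom{n}{d}}(1\pm\epsilon),$$ i.e. the probability lies between $\frac{\binom{k}{d}}{\binom{n}{d}}(1-\epsilon)$ and $\frac{\binom{k}{d}}{\binom{n}{d}}(1+\epsilon)$,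 where $h$ is chosen uniformly at random from $\mathcal{H}$.
   Formalization: h(X) and h(Y) are taken with multiplicity (colliding values counted separately), since as sets the ranks may not exist and the claim fails for n close to u; and n is required to exceed k, so that RANK_{k-d+1}(h(X)) exists. *)

theory Defs
  imports "HOL-Probability.Probability" "HOL-Library.Multiset" "HOL-Library.FuncSet"
begin

text \<open>
  Functions \<open>[u] \<rightarrow> [u]\<close> are represented as extensional functions on \<open>{..<u}\<close>, so that
  distinct members of a family differ at some point of \<open>[u]\<close> and the uniform distribution on
  the family is \<open>pmf_of_set H\<close>.
\<close>

definition hash_family :: "nat \<Rightarrow> (nat \<Rightarrow> nat) set \<Rightarrow> bool" where
  "hash_family u H \<longleftrightarrow> H \<noteq> {} \<and> H \<subseteq> {..<u} \<rightarrow>\<^sub>E {..<u}"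

definition wise_independent :: "nat \<Rightarrow> nat \<Rightarrow> (nat \<Rightarrow> nat) set \<Rightarrow> bool" where
  "wise_independent u l H \<longleftrightarrow>
     hash_family u H \<and>
     (\<forall>x v. inj_on x {..<l} \<and> x ` {..<l} \<subseteq> {..<u} \<and> v ` {..<l} \<subseteq> {..<u} \<longrightarrow>
        measure_pmf.prob (pmf_of_set H) {h. \<forall>i<l. h (x i) = v i} = 1 / real u ^ l)"

text \<open>
  The \<open>j\<close>-th smallest element, with \<open>j\<close> counted from 1; meaningful for \<open>1 \<le> j \<le> size M\<close>.
  The collection \<open>h(X) = {h(x) : x \<in> X}\<close> of hash values is indexed by \<open>X\<close>: if two points of
  \<open>X\<close> collide, their common value is counted twice, as is usual for ranks of hash values.
  (With collided values merged, the rank of \<open>h(X)\<close> need not exist, and for \<open>card X\<close> close to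
  \<open>u\<close> even a truly random \<open>h\<close> is not approximately min-wise independent.)
\<close>

definition RANK :: "nat \<Rightarrow> 'a::linorder multiset \<Rightarrow> 'a" where
  "RANK j M = sorted_list_of_multiset M ! (j - 1)"

definition hash_values :: "('a \<Rightarrow> 'b) \<Rightarrow> 'a set \<Rightarrow> 'b multiset" where
  "hash_values h X = image_mset h (mset_set X)"

text \<open>
  The condition \<open>k - d + 1 \<le> card X\<close>, that is \<open>k < n\<close>, says that the \<open>(k - d + 1)\<close>-th smallest
  hash value of \<open>X\<close> exists.
\<close>

definition approx_min_wise_independent ::
  "nat \<Rightarrow> nat \<Rightarrow> nat \<Rightarrow> real \<Rightarrow> (nat \<Rightarrow> nat) set \<Rightarrow> bool" where
  "approx_min_wise_independent u d k \<epsilon> H \<longleftrightarrow>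
     hash_family u H \<and> 0 < \<epsilon> \<and> \<epsilon> < 1 \<and> d \<le> k \<and>
     (\<forall>n X Y. X \<subseteq> {..<u} \<and> Y \<subseteq> {..<u} \<and> X \<inter> Y = {} \<and>
        d \<le> n \<and> card X = n - d \<and> card Y = d \<and> k - d + 1 \<le> card X \<longrightarrow>
        measure_pmf.prob (pmf_of_set H)
            {h. RANK d (hash_values h Y) < RANK (k - d + 1) (hash_values h X)}
          \<in> {real (k choose d) / real (n choose d) * (1 - \<epsilon>) ..
             real (k choose d) / real (n choose d) * (1 + \<epsilon>)})"

end

theory Submission
  imports Defs
begin

text \<open>
  Put \<open>K = k - 1\<close>, \<open>m = card X\<close> and \<open>T = u * K / m\<close>. The event says that fewer than \<open>K\<close> points of \<open>X\<close>
  hash below \<open>w = max (h y) (h z) + 1\<close>, where \<open>Y = {y, z}\<close>; the expected number of such points is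
  \<open>m * w / u\<close>, which equals \<open>K\<close> at \<open>w = T\<close>. So the event should agree with \<open>w \<le> T\<close>, whose probability is
  about \<open>(T / u)\<^sup>2 = (K / m)\<^sup>2\<close>. Conditioned on the two hash values of \<open>Y\<close> the family is still 6-wise
  independent on \<open>X\<close>. Chebyshev's inequality bounds the probability of disagreement at a given \<open>w\<close> near
  \<open>T\<close>, and a product of three second moments over disjoint parts of \<open>X\<close> does so for large \<open>w\<close>. Summing over
  \<open>w\<close> gives a relative error of order \<open>1 / sqrt K\<close>, which the lower bound on \<open>k\<close> makes smaller than \<open>\<epsilon>\<close>.
\<close>

section \<open>Averages over finite sets\<close>

definition mean :: "'a set \<Rightarrow> ('a \<Rightarrow> real) \<Rightarrow> real" where
  "mean A f = (\<Sum>x\<in>A. f x) / real (card A)"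

lemma mean_mono: "(\<And>x. x \<in> A \<Longrightarrow> f x \<le> g x) \<Longrightarrow> mean A f \<le> mean A g"
  by (simp add: mean_def divide_right_mono sum_mono)

lemma mean_cong: "(\<And>x. x \<in> A \<Longrightarrow> f x = g x) \<Longrightarrow> mean A f = mean A g"
  by (simp add: mean_def)

lemma mean_sum: "mean A (\<lambda>x. \<Sum>i\<in>I. f i x) = (\<Sum>i\<in>I. mean A (f i))"
  unfolding mean_def by (subst sum.swap) (simp add: sum_divide_distrib)

lemma mean_cmult: "mean A (\<lambda>x. c * f x) = c * mean A f"
  by (simp add: mean_def sum_distrib_left)

lemma mean_diff: "mean A (\<lambda>x. f x - g x) = mean A f - mean A g"
  by (simp add: mean_def sum_subtractf diff_divide_distrib)

lemma abs_mean_le: "\<bar>mean A f\<bar> \<le> mean A (\<lambda>x. \<bar>f x\<bar>)"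
  by (simp add: mean_def abs_divide divide_right_mono sum_abs)

lemma prob_pmf_of_set_eq_mean:
  assumes "finite H" "H \<noteq> {}"
  shows "measure_pmf.prob (pmf_of_set H) {h. P h} = mean H (\<lambda>h. of_bool (P h))"
  using assms by (simp add: measure_pmf_of_set mean_def Int_def of_bool_def sum.If_cases)

lemma hash_family_finite: "hash_family u H \<Longrightarrow> finite H"
  unfolding hash_family_def by (meson finite_PiE finite_lessThan finite_subset)

section \<open>Mixed moments under limited independence\<close>

text \<open>Group \<open>H\<close> by restriction to \<open>S\<close>. Independence makes all fibres
  equally large, so the restriction is uniform on \<open>S \<rightarrow>\<^sub>E {..<u}\<close>, and
  distributivity turns the sum over these functions into a product of sums.\<close>

lemma mean_prod_wise_independent_exact:
  assumes wi: "wise_independent u l H" and S: "S \<subseteq> {..<u}" "card S = l"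
  shows "mean H (\<lambda>h. \<Prod>x\<in>S. f x (h x)) = (\<Prod>x\<in>S. mean {..<u} (f x))"
proof -
  have fam: "hash_family u H" using wi by (simp add: wise_independent_def)
  then have H: "finite H" "H \<noteq> {}" "H \<subseteq> {..<u} \<rightarrow>\<^sub>E {..<u}"
    using hash_family_finite[OF fam] by (auto simp: hash_family_def)
  have finS: "finite S" using S finite_subset by blast
  obtain x where x: "bij_betw x {..<l} S"
    using ex_bij_betw_nat_finite[OF finS] S by (auto simp: atLeast0LessThan)
  have fibre: "real (card {h\<in>H. restrict h S = g}) = real (card H) / real u ^ l"
    if g: "g \<in> S \<rightarrow>\<^sub>E {..<u}" for g
  proof -
    have "measure_pmf.prob (pmf_of_set H) {h. \<forall>i<l. h (x i) = g (x i)} = 1 / real u ^ l"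
    proof -
      have "inj_on x {..<l}" "x ` {..<l} \<subseteq> {..<u}" "(\<lambda>i. g (x i)) ` {..<l} \<subseteq> {..<u}"
        using x S g by (auto simp: bij_betw_def PiE_def Pi_def)
      then show ?thesis using wi unfolding wise_independent_def by blast
    qed
    moreover have "(\<forall>i<l. h (x i) = g (x i)) \<longleftrightarrow> restrict h S = g" for h
    proof -
      have "(\<forall>i<l. h (x i) = g (x i)) \<longleftrightarrow> (\<forall>z\<in>S. h z = g z)"
        using x by (auto simp: bij_betw_def)
      also have "\<dots> \<longleftrightarrow> restrict h S = g"
        using g by (force simp: restrict_def PiE_def extensional_def fun_eq_iff)
      finally show ?thesis .
    qed
    ultimately show ?thesis using H
      by (simp add: measure_pmf_of_set Int_def field_simps)
  qed
  have "(\<Sum>h\<in>H. \<Prod>x\<in>S. f x (h x))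
      = (\<Sum>g\<in>S \<rightarrow>\<^sub>E {..<u}. \<Sum>h\<in>{h\<in>H. restrict h S = g}. \<Prod>x\<in>S. f x (h x))"
  proof (rule sum.group[symmetric])
    show "(\<lambda>h. restrict h S) ` H \<subseteq> S \<rightarrow>\<^sub>E {..<u}"
      using H(3) S(1) by (fastforce simp: PiE_def Pi_def)
  qed (use H finS in \<open>auto intro!: finite_PiE\<close>)
  also have "\<dots> = (\<Sum>g\<in>S \<rightarrow>\<^sub>E {..<u}. \<Sum>h\<in>{h\<in>H. restrict h S = g}. \<Prod>x\<in>S. f x (g x))"
    by (intro sum.cong refl prod.cong) auto
  also have "\<dots> = (\<Sum>g\<in>S \<rightarrow>\<^sub>E {..<u}. real (card H) / real u ^ l * (\<Prod>x\<in>S. f x (g x)))"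
    by (intro sum.cong refl) (simp add: fibre)
  also have "\<dots> = real (card H) / real u ^ l * (\<Prod>x\<in>S. \<Sum>v<u. f x v)"
    using finS by (subst prod_sum_PiE) (auto simp: sum_distrib_left)
  finally show ?thesis using H S
    by (simp add: mean_def prod_dividef)
qed

text \<open>\<open>wise_independent\<close> speaks of exactly \<open>l\<close> points, so
  \<open>S\<close> is padded to \<open>l\<close> points carrying the constant factor 1. The
  assumption \<open>l \<le> u\<close> leaves room for the padding.\<close>

lemma mean_prod_wise_independent:
  assumes wi: "wise_independent u l H" and S: "S \<subseteq> {..<u}" "card S \<le> l" and l: "l \<le> u"
  shows "mean H (\<lambda>h. \<Prod>x\<in>S. f x (h x)) = (\<Prod>x\<in>S. mean {..<u} (f x))"
proof -
  obtain S' where S': "S \<subseteq> S'" "S' \<subseteq> {..<u}" "card S' = l"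
    using exists_subset_between[of S l "{..<u}"] S l by auto
  have fin: "finite S'" using S' finite_subset by blast
  define f' where "f' x v = (if x \<in> S then f x v else 1)" for x v
  have 1: "(\<Prod>x\<in>S. f x (h x)) = (\<Prod>x\<in>S'. f' x (h x))" for h
    by (rule prod.mono_neutral_cong_left) (use S' fin in \<open>auto simp: f'_def\<close>)
  have 2: "(\<Prod>x\<in>S. mean {..<u} (f x)) = (\<Prod>x\<in>S'. mean {..<u} (f' x))"
    by (rule prod.mono_neutral_cong_left) (use S' fin in \<open>auto simp: f'_def mean_def\<close>)
  show ?thesis unfolding 1 2 using mean_prod_wise_independent_exact[OF wi S'(2,3)] .
qed

text \<open>Expand one square into pairs of points. A pair of distinct points contributes 0 because
  \<phi> is centred, and a diagonal pair contributes the second moment. Each square uses up two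
  points of independence. The induction varies \<open>S\<close> and \<open>f\<close>, since the
  expanded pair is absorbed into \<open>S\<close>.\<close>

lemma mean_prod_squares_wise_independent:
  assumes wi: "wise_independent u l H" and l: "l \<le> u"
    and \<phi>: "mean {..<u} \<phi> = 0"
    and "S \<subseteq> {..<u}" "card S + 2 * j \<le> l"
    and "\<And>i. i < j \<Longrightarrow> Z i \<subseteq> {..<u}" "\<And>i. i < j \<Longrightarrow> Z i \<inter> S = {}" "disjoint_family_on Z {..<j}"
  shows "mean H (\<lambda>h. (\<Prod>x\<in>S. f x (h x)) * (\<Prod>i<j. (\<Sum>x\<in>Z i. \<phi> (h x))\<^sup>2))
       = (\<Prod>x\<in>S. mean {..<u} (f x)) * (\<Prod>i<j. real (card (Z i)) * mean {..<u} (\<lambda>v. (\<phi> v)\<^sup>2))"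
  using assms(4-)
proof (induction j arbitrary: S f)
  case 0
  then show ?case using mean_prod_wise_independent[OF wi _ _ l] by simp
next
  case (Suc j)
  define s where "s = mean {..<u} (\<lambda>v. (\<phi> v)\<^sup>2)"
  define R where "R = (\<Prod>i<j. real (card (Z i)) * s)"
  define G where "G h = (\<Prod>i<j. (\<Sum>x\<in>Z i. \<phi> (h x))\<^sup>2)" for h
  have finS: "finite S" using Suc.prems(1) finite_subset by blast
  have finZ: "finite (Z j)" using Suc.prems(3)[of j] finite_subset by blast
  have term_eq: "mean H (\<lambda>h. (\<Prod>x\<in>S. f x (h x)) * (\<phi> (h y) * \<phi> (h z)) * G h)
      = of_bool (y = z) * ((\<Prod>x\<in>S. mean {..<u} (f x)) * s * R)"
    if y: "y \<in> Z j" and z: "z \<in> Z j" for y z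
  proof -
    \<comment> \<open>On the diagonal the two factors \<phi> sit at a single point and merge into a
      square; otherwise they occupy two new points.\<close>
    define f' where "f' = (if y = z then f(y := (\<lambda>v. (\<phi> v)\<^sup>2)) else f(y := \<phi>, z := \<phi>))"
    define S' where "S' = S \<union> {y, z}"
    have nin: "y \<notin> S" "z \<notin> S" using Suc.prems(4)[of j] y z by auto
    have card: "card S' \<le> card S + 2"
      unfolding S'_def by (rule order_trans[OF card_Un_le]) (simp add: card_insert_if)
    have dis: "Z i \<inter> S' = {}" if "i < j" for i
    proof -
      have "Z i \<inter> Z j = {}" using Suc.prems(5) that by (auto simp: disjoint_family_on_def)
      then show ?thesis using Suc.prems(4)[of i] that y z by (auto simp: S'_def)
    qed
    have "mean H (\<lambda>h. (\<Prod>x\<in>S'. f' x (h x)) * G h) = (\<Prod>x\<in>S'. mean {..<u} (f' x)) * R"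
      unfolding G_def R_def s_def
    proof (rule Suc.IH)
      show "S' \<subseteq> {..<u}" using Suc.prems(1) Suc.prems(3)[of j] y z by (auto simp: S'_def)
      show "card S' + 2 * j \<le> l" using card Suc.prems(2) by simp
      show "disjoint_family_on Z {..<j}"
        using Suc.prems(5) by (rule disjoint_family_on_mono[rotated]) auto
    qed (use Suc.prems(3) dis in auto)
    moreover have "(\<Prod>x\<in>S'. f' x (h x)) = (\<Prod>x\<in>S. f x (h x)) * (\<phi> (h y) * \<phi> (h z))" for h
    proof -
      have "(\<Prod>x\<in>S. f' x (h x)) = (\<Prod>x\<in>S. f x (h x))"
        by (intro prod.cong refl) (use nin in \<open>auto simp: f'_def\<close>)
      then show ?thesis using nin finS
        by (cases "y = z") (auto simp: S'_def f'_def power2_eq_square)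
    qed
    moreover have "(\<Prod>x\<in>S'. mean {..<u} (f' x))
        = of_bool (y = z) * ((\<Prod>x\<in>S. mean {..<u} (f x)) * s)"
    proof -
      have "(\<Prod>x\<in>S. mean {..<u} (f' x)) = (\<Prod>x\<in>S. mean {..<u} (f x))"
        by (intro prod.cong refl) (use nin in \<open>auto simp: f'_def\<close>)
      then show ?thesis using nin finS \<phi>
        by (cases "y = z") (auto simp: S'_def f'_def s_def)
    qed
    ultimately show ?thesis by (simp add: mult_ac)
  qed
  have "mean H (\<lambda>h. (\<Prod>x\<in>S. f x (h x)) * (\<Prod>i<Suc j. (\<Sum>x\<in>Z i. \<phi> (h x))\<^sup>2))
      = mean H (\<lambda>h. \<Sum>y\<in>Z j. \<Sum>z\<in>Z j. (\<Prod>x\<in>S. f x (h x)) * (\<phi> (h y) * \<phi> (h z)) * G h)"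
    by (rule mean_cong)
      (simp add: G_def power2_eq_square sum_product sum_distrib_left sum_distrib_right mult_ac)
  \<comment> \<open>Only the \<open>card (Z j)\<close> diagonal pairs survive.\<close>
  also have "\<dots> = (\<Sum>y\<in>Z j. \<Sum>z\<in>Z j. of_bool (y = z) * ((\<Prod>x\<in>S. mean {..<u} (f x)) * s * R))"
    unfolding mean_sum by (intro sum.cong refl term_eq)
  also have "\<dots> = real (card (Z j)) * ((\<Prod>x\<in>S. mean {..<u} (f x)) * s * R)"
    using finZ by (simp add: of_bool_def if_distrib[of "\<lambda>t. t * _"] cong: if_cong)
  finally show ?case by (simp add: R_def s_def mult_ac)
qed

section \<open>Order statistics as counts\<close>

lemma nth_sorted_greater_iff:
  fixes xs :: "'a::linorder list"
  assumes "sorted xs" "j < length xs"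
  shows "t < xs ! j \<longleftrightarrow> length (filter (\<lambda>x. x \<le> t) xs) \<le> j"
  using assms
proof (induction xs arbitrary: j)
  case Nil
  then show ?case by simp
next
  case (Cons a xs)
  show ?case
  proof (cases j)
    case 0
    then show ?thesis using Cons.prems
      by (auto simp: filter_empty_conv)
  next
    case (Suc i)
    have "filter (\<lambda>x. x \<le> t) xs = []" if "\<not> a \<le> t"
      using Cons.prems that by (auto simp: filter_empty_conv)
    moreover have "a \<le> xs ! i" using Cons.prems Suc by simp
    ultimately show ?thesis using Cons.prems Suc Cons.IH[of i] by auto
  qed
qed

text \<open>Turns a comparison with an order statistic into a count, to which moment bounds apply.
  \<open>RANK\<close> counts from 1 and list positions from 0, so \<open>\<le> j - 1\<close> becomes
  \<open>< j\<close>, which requires \<open>1 \<le> j\<close>.\<close>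

lemma less_RANK_iff:
  assumes "1 \<le> j" "j \<le> size M"
  shows "t < RANK j M \<longleftrightarrow> size (filter_mset (\<lambda>x. x \<le> t) M) < j"
proof -
  define xs where "xs = sorted_list_of_multiset M"
  have M: "M = mset xs" and s: "sorted xs" by (simp_all add: xs_def)
  have "t < xs ! (j - 1) \<longleftrightarrow> length (filter (\<lambda>x. x \<le> t) xs) \<le> j - 1"
    by (rule nth_sorted_greater_iff[OF s]) (use assms M in auto)
  moreover have "size (filter_mset (\<lambda>x. x \<le> t) M) = length (filter (\<lambda>x. x \<le> t) xs)"
    by (simp add: M flip: mset_filter)
  ultimately show ?thesis using assms by (auto simp: RANK_def xs_def)
qed

lemma less_RANK_hash_values_iff:
  assumes "finite X" "1 \<le> j" "j \<le> card X"
  shows "t < RANK j (hash_values h X) \<longleftrightarrow> card {x\<in>X. h x \<le> t} < j"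
  using assms by (simp add: less_RANK_iff hash_values_def filter_mset_image_mset)

lemma RANK_2_hash_values:
  fixes h :: "'a \<Rightarrow> 'b::linorder"
  assumes "y \<noteq> z"
  shows "RANK 2 (hash_values h {y, z}) = max (h y) (h z)"
proof -
  have "sorted_list_of_multiset {#h y, h z#} = [min (h y) (h z), max (h y) (h z)]"
    by (auto simp: min_def max_def)
  then show ?thesis using assms by (simp add: RANK_def hash_values_def)
qed

section \<open>Summation estimates\<close>

text \<open>Telescoping: \<open>1 / (x + 1)^2 \<le> 1 / (x * (x + 1)) = 1 / x - 1 / (x + 1)\<close>.
  The term nearest to \<open>T\<close> is kept as it is.\<close>

lemma sum_inverse_squares_left:
  fixes T :: real
  assumes "real b < T"
  shows "(\<Sum>w\<le>b. 1 / (real w - T)\<^sup>2) \<le> 1 / (T - real b)\<^sup>2 + 1 / (T - real b)"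
  using assms
proof (induction b)
  case 0
  then show ?case by simp
next
  case (Suc b)
  define x where "x = T - real (Suc b)"
  have x: "x > 0" "T - real b = x + 1" using Suc.prems by (auto simp: x_def)
  have "(\<Sum>w\<le>b. 1 / (real w - T)\<^sup>2) \<le> 1 / (x + 1)\<^sup>2 + 1 / (x + 1)"
    using Suc.IH Suc.prems x by simp
  also have "\<dots> \<le> 1 / (x * (x + 1)) + 1 / (x + 1)"
    using x by (intro add_right_mono divide_left_mono) (auto simp: power2_eq_square)
  also have "\<dots> = 1 / x" using x by (simp add: divide_simps)
  finally show ?case using x by (simp add: x_def power2_commute)
qed

text \<open>The same telescoping to the right of \<open>T\<close>. The negative last term is what
  carries the induction; the application drops it.\<close>

lemma sum_inverse_squares_right:
  fixes T :: real
  assumes "T < real a" "a \<le> b"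
  shows "(\<Sum>w=a..b. 1 / (real w - T)\<^sup>2) \<le> 1 / (real a - T)\<^sup>2 + 1 / (real a - T) - 1 / (real b - T)"
  using assms(2)
proof (induction b rule: dec_induct)
  case base
  then show ?case by simp
next
  case (step b)
  define x where "x = real b - T"
  have x: "x > 0" using step assms by (auto simp: x_def)
  have "1 / (x + 1)\<^sup>2 \<le> 1 / (x * (x + 1))"
    using x by (intro divide_left_mono) (auto simp: power2_eq_square)
  also have "\<dots> = 1 / x - 1 / (x + 1)" using x by (simp add: divide_simps)
  finally have "1 / (real (Suc b) - T)\<^sup>2 \<le> 1 / (real b - T) - 1 / (real (Suc b) - T)"
    by (simp add: x_def algebra_simps)
  then show ?case using step by simp
qed

text \<open>Split at distance \<open>r\<close> from \<open>T\<close>. Each tail gives at most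
  \<open>r^2 * (2 / r) = 2 * r\<close>, and the middle contains at most
  \<open>2 * r + 1 \<le> 3 * r\<close> integers.\<close>

lemma sum_truncated_inverse_squares_le:
  fixes T r :: real
  assumes r: "1 \<le> r" "r \<le> T"
  shows "(\<Sum>w\<le>b. if \<bar>real w - T\<bar> \<le> r then 1 else r\<^sup>2 / (real w - T)\<^sup>2) \<le> 7 * r"
proof -
  define L where "L = {w\<in>{..b}. real w < T - r}"
  define M where "M = {w\<in>{..b}. T - r \<le> real w \<and> real w \<le> T + r}"
  define R where "R = {w\<in>{..b}. T + r < real w}"
  define F where "F w = (if \<bar>real w - T\<bar> \<le> r then 1 else r\<^sup>2 / (real w - T)\<^sup>2)" for w :: nat
  have small: "1 / x\<^sup>2 + 1 / x \<le> 2 / r" if "r \<le> x" for x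
  proof -
    have "1 / x\<^sup>2 \<le> 1 / x" using that r by (intro divide_left_mono) (auto simp: power2_eq_square)
    moreover have "1 / x \<le> 1 / r" using that r by (intro divide_left_mono) auto
    ultimately show ?thesis by simp
  qed
  have scale: "sum F W \<le> 2 * r" if W: "(\<Sum>w\<in>W. 1 / (real w - T)\<^sup>2) \<le> 2 / r"
    and far: "\<And>w. w \<in> W \<Longrightarrow> r < \<bar>real w - T\<bar>" for W
  proof -
    have "sum F W \<le> (\<Sum>w\<in>W. r\<^sup>2 * (1 / (real w - T)\<^sup>2))"
      by (intro sum_mono) (use far in \<open>force simp: F_def\<close>)
    also have "\<dots> \<le> r\<^sup>2 * (2 / r)" unfolding sum_distrib_left[symmetric]
      by (intro mult_left_mono W) auto
    finally show ?thesis using r by (simp add: power2_eq_square)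
  qed
  have "sum F L \<le> 2 * r"
  proof (cases "L = {}")
    case False
    define a where "a = Max L"
    have fin: "finite L" by (simp add: L_def)
    have a: "a \<in> L" "L \<subseteq> {..a}" using False fin by (auto simp: a_def)
    have "(\<Sum>w\<in>L. 1 / (real w - T)\<^sup>2) \<le> (\<Sum>w\<le>a. 1 / (real w - T)\<^sup>2)"
      by (intro sum_mono2) (use a in auto)
    also have "\<dots> \<le> 1 / (T - real a)\<^sup>2 + 1 / (T - real a)"
      by (rule sum_inverse_squares_left) (use a r in \<open>auto simp: L_def\<close>)
    also have "\<dots> \<le> 2 / r" by (rule small) (use a in \<open>auto simp: L_def\<close>)
    finally show ?thesis by (rule scale) (auto simp: L_def)
  qed (use r in auto)
  moreover have "sum F R \<le> 2 * r"
  proof (cases "R = {}")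
    case False
    define a where "a = Min R"
    have fin: "finite R" by (simp add: R_def)
    have a: "a \<in> R" "R \<subseteq> {a..b}" using False fin by (auto simp: a_def) (simp add: R_def)
    have ab: "T < real a" "a \<le> b" "r \<le> real a - T" using a r by (auto simp: R_def)
    have "(\<Sum>w\<in>R. 1 / (real w - T)\<^sup>2) \<le> (\<Sum>w=a..b. 1 / (real w - T)\<^sup>2)"
      by (intro sum_mono2) (use a in auto)
    also have "\<dots> \<le> 1 / (real a - T)\<^sup>2 + 1 / (real a - T) - 1 / (real b - T)"
      by (rule sum_inverse_squares_right) (use ab in auto)
    also have "\<dots> \<le> 1 / (real a - T)\<^sup>2 + 1 / (real a - T)" using ab by simp
    also have "\<dots> \<le> 2 / r" by (rule small) (use ab in auto)
    finally show ?thesis by (rule scale) (auto simp: R_def)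
  qed (use r in auto)
  moreover have "sum F M \<le> 3 * r"
  proof -
    have "sum F M \<le> (\<Sum>w\<in>M. 1)" by (intro sum_mono) (auto simp: F_def M_def)
    also have "\<dots> = real (card M)" by simp
    also have "\<dots> \<le> 3 * r"
    proof -
      \<comment> \<open>Since \<open>r \<le> T\<close>, the lower end is nonnegative and
        \<open>nat\<close> truncates nothing.\<close>
      have "M \<subseteq> {nat \<lceil>T - r\<rceil>..nat \<lfloor>T + r\<rfloor>}" using r by (auto simp: M_def le_nat_iff nat_le_iff le_floor_iff ceiling_le_iff)
      then have "card M \<le> card {nat \<lceil>T - r\<rceil>..nat \<lfloor>T + r\<rfloor>}" by (intro card_mono) auto
      then have "real (card M) \<le> real (Suc (nat \<lfloor>T + r\<rfloor>) - nat \<lceil>T - r\<rceil>)" by simp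
      also have "\<dots> \<le> 2 * r + 1" using r by linarith
      finally show ?thesis using r by simp
    qed
    finally show ?thesis .
  qed
  moreover have "sum F {..b} = sum F L + sum F M + sum F R"
  proof -
    have "{..b} = L \<union> M \<union> R" using r by (auto simp: L_def M_def R_def)
    moreover have "sum F (L \<union> M \<union> R) = sum F (L \<union> M) + sum F R"
      by (rule sum.union_disjoint) (use r in \<open>auto simp: L_def M_def R_def\<close>)
    moreover have "sum F (L \<union> M) = sum F L + sum F M"
      by (rule sum.union_disjoint) (use r in \<open>auto simp: L_def M_def R_def\<close>)
    ultimately show ?thesis by simp
  qed
  ultimately show ?thesis by (simp add: F_def)
qed

text \<open>Exactly \<open>2 * t + 1\<close> pairs have maximum \<open>t\<close>. This is the
  density of the larger of two independent uniform hash values, up to the factor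
  \<open>1 / u^2\<close>.\<close>

lemma sum_max_square:
  fixes F :: "nat \<Rightarrow> real"
  shows "(\<Sum>a<u. \<Sum>b<u. F (max a b)) = (\<Sum>t<u. (2 * real t + 1) * F t)"
proof (induction u)
  case (Suc u)
  have 1: "(\<Sum>b<Suc u. F (max a b)) = (\<Sum>b<u. F (max a b)) + F u" if "a < u" for a
    using that by (simp add: max_def)
  have 2: "(\<Sum>b<Suc u. F (max u b)) = real u * F u + F u"
    by (simp add: max_def)
  show ?case using Suc.IH
    unfolding sum.lessThan_Suc[of _ u] by (simp add: 1 2 sum.distrib algebra_simps flip: sum.lessThan_Suc)
qed simp

section \<open>Deviations of counts, given two hash values\<close>

lemma mean_threshold:
  assumes "0 < u" "w \<le> u"
  shows "mean {..<u} (\<lambda>v. of_bool (v < w)) = real w / real u"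
proof -
  have "{..<u} \<inter> {v. v < w} = {..<w}" using assms by auto
  then show ?thesis using assms by (simp add: mean_def of_bool_def sum.If_cases)
qed

lemma mean_point:
  assumes "a < u"
  shows "mean {..<u} (\<lambda>v. of_bool (v = a)) = 1 / real u"
  using assms by (simp add: mean_def of_bool_def)

lemma mean_const: "0 < u \<Longrightarrow> mean {..<u} (\<lambda>v::nat. c) = c"
  by (simp add: mean_def)

lemma mean_centred_threshold:
  assumes "0 < u" "w \<le> u"
  shows "mean {..<u} (\<lambda>v. of_bool (v < w) - real w / real u) = 0"
  using assms by (simp add: mean_diff mean_threshold mean_const)

text \<open>This is the variance \<open>p - p^2\<close> of an indicator of probability
  \<open>p\<close>, with \<open>p^2\<close> dropped.\<close>

lemma mean_centred_threshold_square_le: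
  assumes "0 < u" "w \<le> u"
  shows "mean {..<u} (\<lambda>v. (of_bool (v < w) - real w / real u)\<^sup>2) \<le> real w / real u"
proof -
  define p where "p = real w / real u"
  have "mean {..<u} (\<lambda>v. (of_bool (v < w) - p)\<^sup>2)
      = mean {..<u} (\<lambda>v. (1 - 2 * p) * of_bool (v < w) - (- p\<^sup>2))"
    by (rule mean_cong) (auto simp: power2_eq_square algebra_simps)
  also have "\<dots> = (1 - 2 * p) * p + p\<^sup>2"
    unfolding mean_diff mean_cmult mean_threshold[OF assms] mean_const[OF assms(1)] p_def by simp
  also have "\<dots> \<le> p" by (simp add: power2_eq_square algebra_simps)
  finally show ?thesis by (simp add: p_def)
qed

text \<open>Conditioning on the hash values of \<open>y\<close> and \<open>z\<close> is expressed by
  an indicator factor: these two points form the set \<open>S\<close> of the moment formula, each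
  with mean \<open>1 / u\<close>, and the \<open>j\<close> squares take the remaining
  \<open>2 * j\<close> points.\<close>

lemma mean_pair_prod_deviations_le:
  assumes wi: "wise_independent u l H" "l \<le> u" "2 + 2 * j \<le> l"
    and yz: "y < u" "z < u" "y \<noteq> z" and ab: "a < u" "b < u" and w: "w \<le> u"
    and Z: "\<And>i. i < j \<Longrightarrow> Z i \<subseteq> {..<u} - {y, z}" "disjoint_family_on Z {..<j}"
  shows "mean H (\<lambda>h. of_bool (h y = a \<and> h z = b) *
           (\<Prod>i<j. (real (card {x\<in>Z i. h x < w}) - real (card (Z i)) * real w / real u)\<^sup>2))
       \<le> 1 / (real u)\<^sup>2 * (\<Prod>i<j. real (card (Z i)) * real w / real u)"
proof -
  define \<phi> where "\<phi> v = of_bool (v < w) - real w / real u" for v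
  define f where "f x v = (of_bool (v = (if x = y then a else b)) :: real)" for x v :: nat
  have u: "0 < u" using yz by simp
  have pair: "(of_bool (h y = a \<and> h z = b) :: real) = (\<Prod>x\<in>{y, z}. f x (h x))" for h
    using yz by (auto simp: f_def)
  have dev: "real (card {x\<in>Z i. h x < w}) - real (card (Z i)) * real w / real u
      = (\<Sum>x\<in>Z i. \<phi> (h x))" if "i < j" for i h
  proof -
    have "finite (Z i)" using Z(1)[OF that] finite_subset by blast
    then show ?thesis
      by (simp add: \<phi>_def sum_subtractf of_bool_def sum.If_cases Int_def)
  qed
  have "mean H (\<lambda>h. of_bool (h y = a \<and> h z = b) *
           (\<Prod>i<j. (real (card {x\<in>Z i. h x < w}) - real (card (Z i)) * real w / real u)\<^sup>2))
      = mean H (\<lambda>h. (\<Prod>x\<in>{y, z}. f x (h x)) * (\<Prod>i<j. (\<Sum>x\<in>Z i. \<phi> (h x))\<^sup>2))"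
    unfolding pair by (intro mean_cong arg_cong2[where f = times] refl prod.cong) (simp add: dev)
  also have "\<dots> = (\<Prod>x\<in>{y, z}. mean {..<u} (f x))
      * (\<Prod>i<j. real (card (Z i)) * mean {..<u} (\<lambda>v. (\<phi> v)\<^sup>2))"
  proof (rule mean_prod_squares_wise_independent[OF wi(1,2)])
    show "mean {..<u} \<phi> = 0" unfolding \<phi>_def using mean_centred_threshold[OF u w] .
    show "Z i \<subseteq> {..<u}" "Z i \<inter> {y, z} = {}" if "i < j" for i using Z(1)[OF that] by auto
  qed (use yz wi Z(2) in auto)
  also have "(\<Prod>x\<in>{y, z}. mean {..<u} (f x)) = 1 / (real u)\<^sup>2"
  proof -
    have "mean {..<u} (f y) = 1 / real u" "mean {..<u} (f z) = 1 / real u"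
      using yz mean_point[OF ab(1)] mean_point[OF ab(2)] by (simp_all add: f_def[abs_def])
    then show ?thesis using yz by (simp add: power2_eq_square)
  qed
  also have "1 / (real u)\<^sup>2 * (\<Prod>i<j. real (card (Z i)) * mean {..<u} (\<lambda>v. (\<phi> v)\<^sup>2))
      \<le> 1 / (real u)\<^sup>2 * (\<Prod>i<j. real (card (Z i)) * real w / real u)"
  proof (intro mult_left_mono prod_mono conjI)
    fix i
    have "mean {..<u} (\<lambda>v. (\<phi> v)\<^sup>2) \<le> real w / real u"
      unfolding \<phi>_def using mean_centred_threshold_square_le[OF u w] .
    then show "real (card (Z i)) * mean {..<u} (\<lambda>v. (\<phi> v)\<^sup>2) \<le> real (card (Z i)) * real w / real u"
      by (metis mult_left_mono of_nat_0_le_iff times_divide_eq_right)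
    show "0 \<le> real (card (Z i)) * mean {..<u} (\<lambda>v. (\<phi> v)\<^sup>2)"
      by (simp add: mean_def sum_nonneg)
  qed simp
  finally show ?thesis .
qed

text \<open>Markov's inequality for a product of \<open>j\<close> squared deviations. It is applied
  with \<open>j = 0\<close> (trivial bound), \<open>j = 1\<close> (Chebyshev) and
  \<open>j = 3\<close> (cubic decay).\<close>

lemma mean_pair_deviation_event_le:
  assumes wi: "wise_independent u l H" "l \<le> u" "2 + 2 * j \<le> l"
    and yz: "y < u" "z < u" "y \<noteq> z" and ab: "a < u" "b < u" and w: "w \<le> u"
    and Z: "\<And>i. i < j \<Longrightarrow> Z i \<subseteq> {..<u} - {y, z}" "disjoint_family_on Z {..<j}"
    and \<delta>: "0 < \<delta>"
    and P: "\<And>h i. P h \<Longrightarrow> i < j \<Longrightarrow>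
        \<delta> \<le> \<bar>real (card {x\<in>Z i. h x < w}) - real (card (Z i)) * real w / real u\<bar>"
  shows "mean H (\<lambda>h. of_bool (h y = a \<and> h z = b \<and> P h))
       \<le> 1 / (real u)\<^sup>2 * (\<Prod>i<j. real (card (Z i)) * real w / real u / \<delta>\<^sup>2)"
proof -
  define D where "D i h = real (card {x\<in>Z i. h x < w}) - real (card (Z i)) * real w / real u" for i h
  have "mean H (\<lambda>h. of_bool (h y = a \<and> h z = b \<and> P h))
      \<le> mean H (\<lambda>h. (1 / \<delta>\<^sup>2) ^ j * (of_bool (h y = a \<and> h z = b) * (\<Prod>i<j. (D i h)\<^sup>2)))"
  proof (rule mean_mono)
    fix h
    show "of_bool (h y = a \<and> h z = b \<and> P h)
        \<le> (1 / \<delta>\<^sup>2) ^ j * (of_bool (h y = a \<and> h z = b) * (\<Prod>i<j. (D i h)\<^sup>2))"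
    proof (cases "P h")
      case True
      have "(\<Prod>i<j. \<delta>\<^sup>2) \<le> (\<Prod>i<j. (D i h)\<^sup>2)"
        using P[OF True] \<delta> by (intro prod_mono) (auto simp: D_def simp flip: abs_le_square_iff)
      then show ?thesis using \<delta> True by (simp add: power_one_over field_simps)
    qed (simp add: prod_nonneg)
  qed
  also have "\<dots> \<le> (1 / \<delta>\<^sup>2) ^ j * (1 / (real u)\<^sup>2 * (\<Prod>i<j. real (card (Z i)) * real w / real u))"
    unfolding mean_cmult D_def
    by (intro mult_left_mono mean_pair_prod_deviations_le[OF wi yz ab w Z]) auto
  also have "\<dots> = 1 / (real u)\<^sup>2 * (\<Prod>i<j. real (card (Z i)) * real w / real u / \<delta>\<^sup>2)"
    by (simp only: prod_dividef prod_constant card_lessThan) (simp add: power_one_over)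
  finally show ?thesis .
qed

section \<open>Misclassification around the critical threshold\<close>

text \<open>The bound \<open>8 \<le> l\<close> pays for the two points of \<open>Y\<close> and three
  squares; \<open>3 \<le> K\<close> makes a third of \<open>X\<close> nonempty.\<close>

locale min_wise_setting =
  fixes u l K :: nat and H :: "(nat \<Rightarrow> nat) set" and X :: "nat set" and y z :: nat
  assumes wi: "wise_independent u l H" and l: "l \<le> u" "8 \<le> l"
    and yz: "y < u" "z < u" "y \<noteq> z" and X: "X \<subseteq> {..<u} - {y, z}"
    and K: "3 \<le> K" "K \<le> card X"
begin

abbreviation m :: real where "m \<equiv> real (card X)"

definition T :: real where "T = real u * real K / m"

text \<open>Moving \<open>w\<close> by \<open>r\<close> moves the expected count
  \<open>K * w / T\<close> by \<open>sqrt K\<close>, which bounds the standard deviation of the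
  count at \<open>w = T\<close>.\<close>

definition r :: real where "r = T / sqrt (real K)"

definition low :: "nat \<Rightarrow> (nat \<Rightarrow> nat) \<Rightarrow> bool" where
  "low w h \<longleftrightarrow> card {x\<in>X. h x < w} < K"

text \<open>Outside the window this is the Chebyshev shape \<open>T^2 / (K * (w - T)^2)\<close>;
  inside the window it is capped at the trivial value 1.\<close>

definition weight :: "nat \<Rightarrow> real" where
  "weight w = (if \<bar>real w - T\<bar> \<le> r then 1 else r\<^sup>2 / (real w - T)\<^sup>2)"

lemma finite_X: "finite X"
  using X finite_subset by blast

lemma card_X_le: "card X \<le> u"
  using card_mono[of "{..<u}" X] X by auto

lemma pos: "0 < u" "0 < m" "0 < T"
  using K yz by (auto simp: T_def)

lemma K_le_T: "real K \<le> T"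
proof -
  have "real K * m \<le> real K * real u" using card_X_le by (intro mult_left_mono) auto
  then show ?thesis using pos by (simp add: T_def field_simps)
qed

lemma T_le_u: "T \<le> real u"
proof -
  have "real u * real K \<le> real u * m" using K by (intro mult_left_mono) auto
  then show ?thesis using pos by (simp add: T_def field_simps)
qed

lemma r_square: "r\<^sup>2 = T\<^sup>2 / real K"
  by (simp add: r_def power_divide)

lemma r_bounds: "1 \<le> r" "r \<le> T"
proof -
  have s: "1 \<le> sqrt (real K)" using K by simp
  have "sqrt (real K) * 1 \<le> sqrt (real K) * sqrt (real K)" using s by (intro mult_left_mono) auto
  then have "sqrt (real K) \<le> T" using K_le_T by simp
  then show "1 \<le> r" using s by (simp add: r_def)
  have "T * 1 \<le> T * sqrt (real K)" using s pos by (intro mult_left_mono) auto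
  then show "r \<le> T" using s by (simp add: r_def field_simps)
qed

lemma expected_count: "m * real w / real u = real K * real w / T"
  using pos K by (simp add: T_def field_simps)

text \<open>A misclassified count lies on the wrong side of \<open>K\<close>, so it misses its
  expectation \<open>K * w / T\<close> by at least the gap between the two, which is \<delta>. The
  variance bound is that same expectation.\<close>

lemma mean_misclassified_le_chebyshev:
  assumes ab: "a < u" "b < u" and w: "w \<le> u" "real w \<noteq> T"
  shows "mean H (\<lambda>h. of_bool (h y = a \<and> h z = b \<and> low w h \<noteq> (real w \<le> T)))
       \<le> 1 / (real u)\<^sup>2 * (real w * T / (real K * (real w - T)\<^sup>2))"
proof -
  define \<delta> where "\<delta> = real K * \<bar>real w - T\<bar> / T"
  have \<delta>: "0 < \<delta>" using w K pos by (simp add: \<delta>_def)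
  have dev: "\<delta> \<le> \<bar>real (card {x\<in>X. h x < w}) - m * real w / real u\<bar>"
    if "low w h \<noteq> (real w \<le> T)" for h
  proof (cases "real w \<le> T")
    case True
    then have "real K \<le> real (card {x\<in>X. h x < w})" using that by (simp add: low_def)
    moreover have "\<delta> = real K - real K * real w / T"
      using True pos by (simp add: \<delta>_def field_simps)
    ultimately show ?thesis using expected_count[of w] by linarith
  next
    case False
    then have "real (card {x\<in>X. h x < w}) < real K" using that by (simp add: low_def)
    moreover have "\<delta> = real K * real w / T - real K"
      using False pos by (simp add: \<delta>_def field_simps)
    ultimately show ?thesis using expected_count[of w] by linarith
  qed
  have "mean H (\<lambda>h. of_bool (h y = a \<and> h z = b \<and> low w h \<noteq> (real w \<le> T)))
      \<le> 1 / (real u)\<^sup>2 * (\<Prod>i<1::nat. m * real w / real u / \<delta>\<^sup>2)"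
    using mean_pair_deviation_event_le[OF wi l(1) _ yz ab w(1), of 1 "\<lambda>_. X" \<delta>] \<delta> dev X l
    by (simp add: disjoint_family_on_def)
  also have "(\<Prod>i<1::nat. m * real w / real u / \<delta>\<^sup>2) = real K * real w / T / \<delta>\<^sup>2"
    by (simp add: expected_count)
  also have "\<dots> = real w * T / (real K * (real w - T)\<^sup>2)"
  proof -
    have "\<delta>\<^sup>2 = real K * real K * (real w - T)\<^sup>2 / (T * T)"
      by (simp add: \<delta>_def power_mult_distrib power_divide power2_eq_square)
    then show ?thesis using pos K by simp
  qed
  finally show ?thesis .
qed

text \<open>
  Beyond \<open>10 * T\<close> Chebyshev's bound decays too slowly to be summed against the density of the maximum
  of two hash values. Too few small hash values in \<open>X\<close> means too few in each of three disjoint thirds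
  of \<open>X\<close>, and the product of the three squared deviations involves only six points of \<open>X\<close>.
\<close>

lemma mean_misclassified_le_cubic:
  assumes ab: "a < u" "b < u" and w: "w \<le> u" "10 * T < real w"
  shows "mean H (\<lambda>h. of_bool (h y = a \<and> h z = b \<and> low w h \<noteq> (real w \<le> T)))
       \<le> 1 / (real u)\<^sup>2 * (20 * T / (real K * real w)) ^ 3"
proof -
  define q where "q = card X div 3"
  \<comment> \<open>The remainder modulo 3 is at most 2, and \<open>2 \<le> 2 * q\<close>.\<close>
  have q: "m \<le> 5 * real q" "3 * q \<le> card X" "0 < q"
  proof -
    have "card X = 3 * q + card X mod 3" "card X mod 3 < 3" by (simp_all add: q_def)
    moreover have "0 < q" using K by (simp add: q_def div_greater_zero_iff)
    ultimately have "card X \<le> 5 * q" "3 * q \<le> card X" "0 < q" by linarith+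
    then show "m \<le> 5 * real q" "3 * q \<le> card X" "0 < q" by linarith+
  qed
  obtain Z0 where Z0: "Z0 \<subseteq> X" "card Z0 = q"
    using obtain_subset_with_card_n[of q X] q by auto
  obtain Z1 where Z1: "Z1 \<subseteq> X - Z0" "card Z1 = q"
  proof -
    have "card (X - Z0) = card X - q" using Z0 finite_X by (metis card_Diff_subset finite_subset)
    then have "q \<le> card (X - Z0)" using q by linarith
    then show ?thesis using obtain_subset_with_card_n that by blast
  qed
  have "card (X - Z0 - Z1) = card X - q - q"
    using Z0 Z1 finite_X by (metis card_Diff_subset finite_Diff finite_subset)
  then have "q \<le> card (X - Z0 - Z1)" using q by linarith
  then obtain Z2 where Z2: "Z2 \<subseteq> X - Z0 - Z1" "card Z2 = q"
    using obtain_subset_with_card_n by blast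
  define Z where "Z i = (if i = 0 then Z0 else if i = 1 then Z1 else Z2)" for i :: nat
  have Z: "Z i \<subseteq> X" "card (Z i) = q" for i using Z0 Z1 Z2 by (auto simp: Z_def)
  have disj: "disjoint_family_on Z {..<3}"
    using Z0 Z1 Z2 by (auto simp: disjoint_family_on_def Z_def)
  define \<mu> where "\<mu> = real q * real w / real u"
  have \<mu>: "real K * real w / T \<le> 5 * \<mu>"
  proof -
    have "m * real w / real u \<le> 5 * real q * real w / real u"
      using q by (intro divide_right_mono mult_right_mono) auto
    then show ?thesis by (simp add: expected_count \<mu>_def)
  qed
  have "10 * real K \<le> real K * real w / T"
  proof -
    have "real K * (10 * T) \<le> real K * real w" using w by (intro mult_left_mono) auto
    then show ?thesis using pos by (simp add: field_simps)
  qed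
  then have \<mu>K: "2 * real K \<le> \<mu>" using \<mu> by linarith
  then have \<mu>0: "0 < \<mu>" using K by linarith
  \<comment> \<open>The threshold \<open>10 * T\<close> was chosen for this: it gives \<mu> at least
    \<open>2 * K\<close>, so a count below \<open>K\<close> misses \<mu> by at least half.\<close>
  have dev: "\<mu> / 2 \<le> \<bar>real (card {x\<in>Z i. h x < w}) - real (card (Z i)) * real w / real u\<bar>"
    if "low w h \<noteq> (real w \<le> T)" for h i
  proof -
    have "card {x\<in>Z i. h x < w} \<le> card {x\<in>X. h x < w}"
      using finite_X Z(1)[of i] by (intro card_mono) auto
    moreover have "card {x\<in>X. h x < w} < K" using that w pos by (auto simp: low_def)
    ultimately show ?thesis using \<mu>K Z(2)[of i] unfolding \<mu>_def[symmetric]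
      by (simp add: \<mu>_def[symmetric])
  qed
  have "mean H (\<lambda>h. of_bool (h y = a \<and> h z = b \<and> low w h \<noteq> (real w \<le> T)))
      \<le> 1 / (real u)\<^sup>2 * (\<Prod>i<3::nat. real (card (Z i)) * real w / real u / (\<mu> / 2)\<^sup>2)"
    by (rule mean_pair_deviation_event_le[OF wi l(1) _ yz ab w(1) _ disj])
      (use Z X l dev \<mu>0 in auto)
  \<comment> \<open>Each factor is \<mu> divided by the square of \<mu>/2. With \<mu> at least
    \<open>K * w / (5 * T)\<close>, the 4 becomes 20.\<close>
  also have "(\<Prod>i<3::nat. real (card (Z i)) * real w / real u / (\<mu> / 2)\<^sup>2) = (4 / \<mu>) ^ 3"
  proof -
    have "real (card (Z i)) * real w / real u / (\<mu> / 2)\<^sup>2 = 4 / \<mu>" for i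
      using \<mu>0 unfolding Z(2) \<mu>_def[symmetric] by (simp add: power2_eq_square field_simps)
    then show ?thesis by simp
  qed
  also have "1 / (real u)\<^sup>2 * (4 / \<mu>) ^ 3 \<le> 1 / (real u)\<^sup>2 * (20 * T / (real K * real w)) ^ 3"
  proof (intro mult_left_mono power_mono)
    have "0 < real w" using w pos by linarith
    then show "4 / \<mu> \<le> 20 * T / (real K * real w)"
      using \<mu> \<mu>0 pos K by (simp add: field_simps)
  qed (use \<mu>0 in auto)
  finally show ?thesis .
qed

text \<open>One bound for three ranges: trivial within \<open>r\<close> of \<open>T\<close>,
  Chebyshev up to \<open>10 * T\<close>, cubic beyond. The divisor \<open>w\<close> is there to
  cancel the density of the maximum, and \<open>8000 = 20^3\<close> comes from the cubic
  range.\<close>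

lemma mean_misclassified_le_weight:
  assumes ab: "a < u" "b < u" and w: "w \<le> u" "0 < w"
  shows "mean H (\<lambda>h. of_bool (h y = a \<and> h z = b \<and> low w h \<noteq> (real w \<le> T)))
       \<le> 8000 * T / (real u)\<^sup>2 * (weight w / real w)"
proof -
  define B where "B = mean H (\<lambda>h. of_bool (h y = a \<and> h z = b \<and> low w h \<noteq> (real w \<le> T)))"
  have "\<exists>x. B \<le> 1 / (real u)\<^sup>2 * x \<and> x * real w \<le> 8000 * T * weight w"
  proof (cases "\<bar>real w - T\<bar> \<le> r")
    case True
    have "B \<le> 1 / (real u)\<^sup>2 * 1"
      \<comment> \<open>With \<open>j = 0\<close> the product is empty, so the value 1 for \<delta>
        is arbitrary and only the pair probability \<open>1 / u^2\<close> remains.\<close>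
      using mean_pair_deviation_event_le[OF wi l(1) _ yz ab w(1), of 0 _ 1] l
      by (simp add: B_def disjoint_family_on_def)
    moreover have "real w \<le> 2 * T" using True r_bounds by linarith
    ultimately show ?thesis using True pos by (intro exI[of _ 1]) (simp add: weight_def)
  next
    case far: False
    then have ne: "real w \<noteq> T" using r_bounds by auto
    have wt: "T * weight w = T ^ 3 / (real K * (real w - T)\<^sup>2)"
      using far by (simp add: weight_def r_square) (simp add: power2_eq_square power3_eq_cube)
    show ?thesis
    proof (cases "real w \<le> 10 * T")
      case True
      have "(real w)\<^sup>2 \<le> (10 * T)\<^sup>2" using True by (intro power_mono) auto
      then have "(real w)\<^sup>2 * T \<le> 100 * T ^ 3"
        using pos by (simp add: power2_eq_square power3_eq_cube mult_right_mono)
      then have "(real w)\<^sup>2 * T / (real K * (real w - T)\<^sup>2) \<le> 100 * T ^ 3 / (real K * (real w - T)\<^sup>2)"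
        by (intro divide_right_mono) auto
      also have "\<dots> = 100 * (T * weight w)" unfolding wt by simp
      also have "\<dots> \<le> 8000 * T * weight w" using pos by (simp add: weight_def)
      finally have "real w * T / (real K * (real w - T)\<^sup>2) * real w \<le> 8000 * T * weight w"
        by (simp add: power2_eq_square mult_ac)
      then show ?thesis
        using mean_misclassified_le_chebyshev[OF ab w(1) ne] unfolding B_def by blast
    next
      case False
      have K1: "real K \<le> real K ^ 3" using K power_increasing[of 1 3 "real K"] by simp
      have "(20 * T / (real K * real w)) ^ 3 * real w = 8000 * (T ^ 3 / (real K ^ 3 * (real w)\<^sup>2))"
        using w by (simp add: power_divide power_mult_distrib power2_eq_square power3_eq_cube mult_ac)
      \<comment> \<open>The cubic bound is weakened to the common shape by
        \<open>K \<le> K^3\<close> and \<open>w - T \<le> w\<close>.\<close>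
      also have "\<dots> \<le> 8000 * (T ^ 3 / (real K * (real w - T)\<^sup>2))"
      proof (intro mult_left_mono divide_left_mono mult_mono K1 power_mono)
        show "0 < real K ^ 3 * (real w)\<^sup>2 * (real K * (real w - T)\<^sup>2)" using K w ne by simp
      qed (use False pos in auto)
      also have "\<dots> = 8000 * T * weight w" unfolding mult.assoc wt ..
      finally show ?thesis
        using mean_misclassified_le_cubic[OF ab w(1)] False unfolding B_def by force
    qed
  qed
  then obtain x where x: "B \<le> 1 / (real u)\<^sup>2 * x" "x * real w \<le> 8000 * T * weight w" by blast
  have "x \<le> 8000 * T * weight w / real w" using x(2) w by (simp add: field_simps)
  then have "1 / (real u)\<^sup>2 * x \<le> 1 / (real u)\<^sup>2 * (8000 * T * weight w / real w)"
    by (intro mult_left_mono) auto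
  then show ?thesis using x(1) unfolding B_def by simp
qed

text \<open>Split by the hash values of \<open>y\<close> and \<open>z\<close> and sum over their
  maximum. The weights add up to at most \<open>7 * r = 7 * T / sqrt K\<close>, and
  \<open>112000 = 2 * 8000 * 7\<close>.\<close>

lemma mean_misclassified_max_le:
  "mean H (\<lambda>h. of_bool (low (Suc (max (h y) (h z))) h \<noteq> (real (Suc (max (h y) (h z))) \<le> T)))
     \<le> 112000 * (T / real u)\<^sup>2 / sqrt (real K)"
proof -
  define Q where "Q w h \<longleftrightarrow> low w h \<noteq> (real w \<le> T)" for w h
  define F where "F t = 8000 * T / (real u)\<^sup>2 * (weight (Suc t) / real (Suc t))" for t
  have H: "h y < u" "h z < u" if "h \<in> H" for h
    using that wi yz by (auto simp: wise_independent_def hash_family_def PiE_def Pi_def)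
  have split: "(of_bool (Q (Suc (max (h y) (h z))) h) :: real)
      = (\<Sum>a<u. \<Sum>b<u. of_bool (h y = a \<and> h z = b \<and> Q (Suc (max a b)) h))" if "h \<in> H" for h
  proof -
    have "(\<Sum>b<u. of_bool (h y = a \<and> h z = b \<and> Q (Suc (max a b)) h))
        = (if h y = a then of_bool (Q (Suc (max a (h z))) h) else (0::real))" for a
    proof -
      have "(\<Sum>b<u. of_bool (h y = a \<and> h z = b \<and> Q (Suc (max a b)) h))
          = (\<Sum>b<u. if h z = b then of_bool (h y = a \<and> Q (Suc (max a b)) h) else (0::real))"
        by (intro sum.cong) auto
      then show ?thesis using H[OF that] by simp
    qed
    then show ?thesis using H[OF that] by simp
  qed
  have "mean H (\<lambda>h. of_bool (Q (Suc (max (h y) (h z))) h))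
      = (\<Sum>a<u. \<Sum>b<u. mean H (\<lambda>h. of_bool (h y = a \<and> h z = b \<and> Q (Suc (max a b)) h)))"
    unfolding mean_sum[symmetric] by (rule mean_cong) (rule split)
  also have "\<dots> \<le> (\<Sum>a<u. \<Sum>b<u. F (max a b))"
    unfolding F_def Q_def by (intro sum_mono mean_misclassified_le_weight) auto
  also have "\<dots> = (\<Sum>t<u. (2 * real t + 1) * F t)" by (rule sum_max_square)
  also have "\<dots> \<le> (\<Sum>t<u. 16000 * T / (real u)\<^sup>2 * weight (Suc t))"
  proof (rule sum_mono)
    fix t
    have wt: "0 \<le> weight (Suc t)" by (simp add: weight_def)
    then have F: "0 \<le> F t" using pos by (simp add: F_def)
    \<comment> \<open>Rounding the density up to \<open>2 * Suc t\<close> makes it cancel the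
      divisor \<open>Suc t\<close> in \<open>F t\<close>.\<close>
    have "(2 * real t + 1) * F t \<le> (2 * real (Suc t)) * F t"
      using F by (intro mult_right_mono) auto
    also have "\<dots> = 16000 * T / (real u)\<^sup>2 * weight (Suc t)"
      by (simp add: F_def del: of_nat_Suc)
    finally show "(2 * real t + 1) * F t \<le> 16000 * T / (real u)\<^sup>2 * weight (Suc t)" .
  qed
  also have "\<dots> = 16000 * T / (real u)\<^sup>2 * (\<Sum>t<u. weight (Suc t))"
    by (simp add: sum_distrib_left)
  also have "\<dots> \<le> 16000 * T / (real u)\<^sup>2 * (7 * r)"
  proof (rule mult_left_mono)
    have "(\<Sum>t<u. weight (Suc t)) = sum weight (Suc ` {..<u})" by (simp add: sum.reindex)
    also have "\<dots> \<le> sum weight {..u}" by (intro sum_mono2) (auto simp: weight_def)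
    also have "\<dots> \<le> 7 * r"
      unfolding weight_def by (rule sum_truncated_inverse_squares_le[OF r_bounds])
    finally show "(\<Sum>t<u. weight (Suc t)) \<le> 7 * r" .
  qed (use pos in simp)
  also have "\<dots> = 112000 * (T / real u)\<^sup>2 / sqrt (real K)"
    by (simp add: r_def power_divide power2_eq_square)
  finally show ?thesis by (simp add: Q_def)
qed

lemma mean_max_threshold:
  assumes "s \<le> u"
  shows "mean H (\<lambda>h. of_bool (max (h y) (h z) < s)) = (real s / real u)\<^sup>2"
proof -
  have "mean H (\<lambda>h. of_bool (max (h y) (h z) < s)) = mean H (\<lambda>h. \<Prod>x\<in>{y, z}. of_bool (h x < s))"
    using yz by (intro mean_cong) auto
  also have "\<dots> = (\<Prod>x\<in>{y, z}. mean {..<u} (\<lambda>v. of_bool (v < s)))"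
    by (rule mean_prod_wise_independent[OF wi]) (use yz l in auto)
  finally show ?thesis using yz assms pos by (simp add: mean_threshold power2_eq_square)
qed

text \<open>The event is compared with \<open>w \<le> T\<close>, whose probability is computed
  exactly after rounding \<open>T\<close> down to an integer. The rounding adds 2 to the constant
  112000.\<close>

lemma mean_low_max_approx:
  "\<bar>mean H (\<lambda>h. of_bool (low (Suc (max (h y) (h z))) h)) - (real K / m)\<^sup>2\<bar>
     \<le> 112002 * (real K / m)\<^sup>2 / sqrt (real K)"
proof -
  define M where "M h = Suc (max (h y) (h z))" for h :: "nat \<Rightarrow> nat"
  \<comment> \<open>As \<open>w\<close> is the maximum plus one, \<open>w \<le> T\<close> says that
    the maximum is below the floor of \<open>T\<close>.\<close>
  define s where "s = nat \<lfloor>T\<rfloor>"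
  have TK: "T / real u = real K / m" using pos by (simp add: T_def)
  have s: "real s \<le> T" "T - 1 < real s" "s \<le> u" using pos T_le_u unfolding s_def by linarith+
  have Ms: "real (M h) \<le> T \<longleftrightarrow> max (h y) (h z) < s" for h
    using pos by (simp add: M_def s_def le_nat_iff le_floor_iff Suc_le_eq[symmetric] del: max_less_iff_conj of_nat_Suc)
  have "\<bar>mean H (\<lambda>h. of_bool (low (M h) h)) - (real s / real u)\<^sup>2\<bar>
      = \<bar>mean H (\<lambda>h. of_bool (low (M h) h) - of_bool (real (M h) \<le> T))\<bar>"
    unfolding mean_diff Ms mean_max_threshold[OF s(3)] ..
  also have "\<dots> \<le> mean H (\<lambda>h. \<bar>of_bool (low (M h) h) - of_bool (real (M h) \<le> T)\<bar>)"
    by (rule abs_mean_le)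
  also have "\<dots> = mean H (\<lambda>h. of_bool (low (M h) h \<noteq> (real (M h) \<le> T)))"
    by (rule mean_cong) auto
  also have "\<dots> \<le> 112000 * (T / real u)\<^sup>2 / sqrt (real K)"
    unfolding M_def by (rule mean_misclassified_max_le)
  finally have 1: "\<bar>mean H (\<lambda>h. of_bool (low (M h) h)) - (real s / real u)\<^sup>2\<bar>
      \<le> 112000 * (T / real u)\<^sup>2 / sqrt (real K)" .
  have "\<bar>(real s)\<^sup>2 - T\<^sup>2\<bar> \<le> 2 * T\<^sup>2 / sqrt (real K)"
  proof -
    have "T\<^sup>2 - (real s)\<^sup>2 = (T - real s) * (T + real s)" by (simp add: power2_eq_square algebra_simps)
    also have "\<dots> \<le> 1 * (2 * T)" using s by (intro mult_mono) auto
    \<comment> \<open>The rounding error is absorbed by \<open>1 \<le> r\<close>, so that it scales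
      like the main error.\<close>
    also have "\<dots> \<le> 2 * T * r" using r_bounds pos by simp
    also have "\<dots> = 2 * T\<^sup>2 / sqrt (real K)" by (simp add: r_def power2_eq_square)
    finally have "T\<^sup>2 - (real s)\<^sup>2 \<le> 2 * T\<^sup>2 / sqrt (real K)" .
    moreover have "(real s)\<^sup>2 \<le> T\<^sup>2" using s by (intro power_mono) auto
    ultimately show ?thesis by simp
  qed
  then have "\<bar>(real s)\<^sup>2 - T\<^sup>2\<bar> / (real u)\<^sup>2 \<le> 2 * T\<^sup>2 / sqrt (real K) / (real u)\<^sup>2"
    by (intro divide_right_mono) auto
  then have 2: "\<bar>(real s / real u)\<^sup>2 - (T / real u)\<^sup>2\<bar> \<le> 2 * (T / real u)\<^sup>2 / sqrt (real K)"
    by (simp add: power_divide abs_divide diff_divide_distrib[symmetric] mult_ac)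
  have "\<bar>mean H (\<lambda>h. of_bool (low (M h) h)) - (T / real u)\<^sup>2\<bar>
      \<le> 112000 * (T / real u)\<^sup>2 / sqrt (real K) + 2 * (T / real u)\<^sup>2 / sqrt (real K)"
    using 1 2 by linarith
  also have "\<dots> = 112002 * (T / real u)\<^sup>2 / sqrt (real K)"
    by (simp add: add_divide_distrib[symmetric])
  finally show ?thesis unfolding TK M_def .
qed

end

section \<open>Comparison with the binomial ratio\<close>

text \<open>\<open>B\<close> is the quotient of \<open>k choose 2\<close> and
  \<open>n choose 2\<close> for \<open>k = K + 1\<close> and \<open>n = m + 2\<close>. The quotient
  \<open>Q\<close> of \<open>(K / m)^2\<close> by \<open>B\<close> lies between
  \<open>1 - 1 / K\<close> and \<open>1 + 5 / m\<close>, because \<open>K / (K + 1)\<close> and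
  \<open>(m + 2) * (m + 1) / m^2\<close> are both close to 1.\<close>

lemma binomial_ratio_approx:
  fixes K m :: real
  assumes "1 \<le> K" "K \<le> m"
  defines "B \<equiv> (K + 1) * K / ((m + 2) * (m + 1))"
  shows "\<bar>(K / m)\<^sup>2 - B\<bar> \<le> 5 * B / K"
proof -
  have m: "1 \<le> m" using assms by linarith
  have "B > 0" using assms m by (simp add: B_def)
  define Q where "Q = K / (K + 1) * ((m + 2) * (m + 1) / m\<^sup>2)"
  have R: "(K / m)\<^sup>2 = B * Q"
    using assms(1) m by (simp add: B_def Q_def power_divide power2_eq_square add_pos_pos)
  have up: "Q \<le> 1 + 5 / K"
  proof -
    have "Q \<le> 1 * ((m + 2) * (m + 1) / m\<^sup>2)"
      unfolding Q_def using assms(1) m by (intro mult_right_mono) auto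
    also have "\<dots> \<le> 1 + 5 / m"
    proof -
      have "(m + 2) * (m + 1) \<le> m\<^sup>2 + 5 * m" using m by (simp add: power2_eq_square algebra_simps)
      then have "(m + 2) * (m + 1) / m\<^sup>2 \<le> (m\<^sup>2 + 5 * m) / m\<^sup>2" by (intro divide_right_mono) auto
      then show ?thesis using m by (simp add: add_divide_distrib power2_eq_square)
    qed
    also have "\<dots> \<le> 1 + 5 / K" using assms(1,2) by (intro add_left_mono divide_left_mono) auto
    finally show ?thesis .
  qed
  have lo: "1 - 1 / K \<le> Q"
  proof -
    have "m\<^sup>2 \<le> (m + 2) * (m + 1)" using m by (simp add: power2_eq_square algebra_simps)
    then have ge1: "1 \<le> (m + 2) * (m + 1) / m\<^sup>2" using m by (simp add: field_simps)
    have "1 - 1 / K \<le> K / (K + 1) * 1" using assms(1) by (simp add: field_simps)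
    also have "\<dots> \<le> Q"
      unfolding Q_def by (rule mult_left_mono[OF ge1]) (use assms(1) in auto)
    finally show ?thesis .
  qed
  have "\<bar>Q - 1\<bar> \<le> 5 / K"
  proof -
    have "1 / K \<le> 5 / K" using assms(1) by (intro divide_right_mono) auto
    then show ?thesis using up lo by linarith
  qed
  then have "B * \<bar>Q - 1\<bar> \<le> B * (5 / K)"
    using \<open>B > 0\<close> by (intro mult_left_mono) auto
  moreover have "B * \<bar>Q - 1\<bar> = \<bar>(K / m)\<^sup>2 - B\<bar>"
    unfolding R using \<open>B > 0\<close> abs_mult[of B "Q - 1"] by (simp add: right_diff_distrib)
  ultimately show ?thesis by (simp add: mult.commute)
qed

text \<open>The preceding estimate yields \<open>(K / m)^2 \<le> 6 * B\<close>, so the errors add up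
  to \<open>6 * 112002 + 5 = 672017\<close>, rounded up to 700000.\<close>

lemma abs_diff_binomial_ratio_le:
  fixes K m P :: real
  assumes K: "1 \<le> K" "K \<le> m" and P: "\<bar>P - (K / m)\<^sup>2\<bar> \<le> 112002 * (K / m)\<^sup>2 / sqrt K"
  defines "B \<equiv> (K + 1) * K / ((m + 2) * (m + 1))"
  shows "\<bar>P - B\<bar> \<le> 700000 * B / sqrt K"
proof -
  have B: "0 \<le> B" using K by (simp add: B_def)
  have R: "\<bar>(K / m)\<^sup>2 - B\<bar> \<le> 5 * B / K"
    unfolding B_def using binomial_ratio_approx[OF K] .
  have s: "1 \<le> sqrt K" using K by simp
  have "sqrt K * 1 \<le> sqrt K * sqrt K" using s by (intro mult_left_mono) auto
  then have sK: "sqrt K \<le> K" using K by simp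
  have 1: "5 * B / K \<le> 5 * B / sqrt K" using sK s B K by (intro divide_left_mono) auto
  have "5 * B / K \<le> 5 * B / 1" using K B by (intro divide_left_mono) auto
  then have R6: "(K / m)\<^sup>2 \<le> 6 * B" using R by linarith
  have "112002 * (K / m)\<^sup>2 / sqrt K \<le> 112002 * (6 * B) / sqrt K"
    using R6 s by (intro divide_right_mono mult_left_mono) auto
  then have "\<bar>P - B\<bar> \<le> 112002 * (6 * B) / sqrt K + 5 * B / sqrt K"
    using P R 1 by linarith
  also have "\<dots> \<le> 700000 * B / sqrt K"
    using B s by (simp add: add_divide_distrib[symmetric] divide_right_mono)
  finally show ?thesis .
qed

lemma real_choose_two: "real (Suc j choose 2) = (real j + 1) * real j / 2"
  by (simp add: choose_two real_of_nat_div algebra_simps)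

section \<open>From the estimates to min-wise independence\<close>

text \<open>The condition \<open>big\<close> says that the relative error
  \<open>700000 / sqrt K\<close> is at most \<epsilon>. From \<open>l < k\<close> follow
  \<open>8 \<le> K\<close> and \<open>l \<le> K\<close>.\<close>

lemma approx_two_min_wise_independent:
  assumes wi: "wise_independent u l H" and l: "8 \<le> l" "l < k" and \<epsilon>: "0 < \<epsilon>" "\<epsilon> < 1"
    and big: "(700000 / \<epsilon>)\<^sup>2 \<le> real k - 1"
  shows "approx_min_wise_independent u 2 k \<epsilon> H"
  unfolding approx_min_wise_independent_def
proof (intro conjI allI impI)
  show fam: "hash_family u H" using wi by (simp add: wise_independent_def)
  show "0 < \<epsilon>" "\<epsilon> < 1" "2 \<le> k" using \<epsilon> l by auto
  fix n :: nat and X Y :: "nat set"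
  assume *: "X \<subseteq> {..<u} \<and> Y \<subseteq> {..<u} \<and> X \<inter> Y = {} \<and>
    2 \<le> n \<and> card X = n - 2 \<and> card Y = 2 \<and> k - 2 + 1 \<le> card X"
  then obtain y z where Y: "Y = {y, z}" "y \<noteq> z" by (auto simp: card_2_iff)
  define K where "K = k - 1"
  have K': "k - 2 + 1 = K" "k = Suc K" "8 \<le> K" "l \<le> K" using l by (auto simp: K_def)
  have XK: "K \<le> card X" using * K' by simp
  have finX: "finite X" using * finite_subset by blast
  \<comment> \<open>Together with \<open>l \<le> K \<le> card X\<close> this gives the
    \<open>l \<le> u\<close> that the locale requires.\<close>
  have "card X \<le> u" using * card_mono[of "{..<u}" X] by auto
  then interpret min_wise_setting u l K H X y z
    by unfold_locales (use * Y wi l K' XK in auto)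
  define P where "P = measure_pmf.prob (pmf_of_set H)
      {h. RANK 2 (hash_values h Y) < RANK (k - 2 + 1) (hash_values h X)}"
  have "P = mean H (\<lambda>h. of_bool (low (Suc (max (h y) (h z))) h))"
  proof -
    have "RANK 2 (hash_values h Y) < RANK (k - 2 + 1) (hash_values h X)
        \<longleftrightarrow> low (Suc (max (h y) (h z))) h" for h
      unfolding Y(1) RANK_2_hash_values[OF Y(2)] K'(1) low_def
      using less_RANK_hash_values_iff[OF finX _ XK] K'
      by (simp add: less_Suc_eq_le del: max_less_iff_conj)
    then show ?thesis unfolding P_def
      using prob_pmf_of_set_eq_mean[OF hash_family_finite[OF fam]] fam by (simp add: hash_family_def)
  qed
  then have P: "\<bar>P - (real K / m)\<^sup>2\<bar> \<le> 112002 * (real K / m)\<^sup>2 / sqrt (real K)"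
    using mean_low_max_approx by simp
  define B where "B = (real K + 1) * real K / ((m + 2) * (m + 1))"
  have "n = Suc (Suc (card X))" using * by linarith
  then have B: "real (k choose 2) / real (n choose 2) = B"
    unfolding K'(2) B_def by (simp add: real_choose_two add_ac)
  have PB: "\<bar>P - B\<bar> \<le> 700000 * B / sqrt (real K)"
    unfolding B_def by (rule abs_diff_binomial_ratio_le[OF _ _ P]) (use K' XK in auto)
  have "700000 / \<epsilon> \<le> sqrt (real K)"
    by (rule real_le_rsqrt) (use big K' in auto)
  then have "700000 / sqrt (real K) \<le> \<epsilon>" using \<epsilon> K' by (simp add: field_simps)
  moreover have "0 \<le> B" by (simp add: B_def)
  ultimately have "B * (700000 / sqrt (real K)) \<le> B * \<epsilon>" by (intro mult_left_mono) auto
  then have "\<bar>P - B\<bar> \<le> B * \<epsilon>" using PB by (simp add: mult.commute)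
  then show "P \<in> {real (k choose 2) / real (n choose 2) * (1 - \<epsilon>) ..
      real (k choose 2) / real (n choose 2) * (1 + \<epsilon>)}"
    unfolding B by (simp add: algebra_simps abs_le_iff)
qed

text \<open>The witness for \<open>c\<close> is the error constant 700000. As
  \<open>8 powr (2 / l) \<ge> 1\<close> and \<open>(6 * l) powr (1 + 1 / l) \<ge> l\<close>, the
  bound on \<open>k\<close> implies \<open>l * (c / \<epsilon>)^2 < k - 1\<close>. Both factors are
  at least 1, so each of them alone is below \<open>k - 1\<close>.\<close>

theorem theorem1:
  "\<exists>c::real. c > 0 \<and>
     (\<forall>(d::nat) (\<epsilon>::real) (\<epsilon>'::real) (k::nat) (l::nat) (u::nat) (H :: (nat \<Rightarrow> nat) set).
        d = 2 \<longrightarrow> 0 < \<epsilon> \<longrightarrow> \<epsilon> < 1 \<longrightarrow> \<epsilon>' = \<epsilon> / c \<longrightarrow>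
        k > 0 \<longrightarrow> l > 0 \<longrightarrow>
        real k > real d - 1
                 + 2 * 8 powr (2 / real l) * ((6 * real l) powr (1 + 1 / real l) / \<epsilon>'\<^sup>2) \<longrightarrow>
        l \<ge> 3 * d + 2 \<longrightarrow>
        wise_independent u l H \<longrightarrow>
        approx_min_wise_independent u d k \<epsilon> H)"
proof (intro exI[of _ 700000] conjI allI impI)
  fix d k l u :: nat and \<epsilon> \<epsilon>' :: real and H :: "(nat \<Rightarrow> nat) set"
  assume d: "d = 2" and \<epsilon>: "0 < \<epsilon>" "\<epsilon> < 1" and \<epsilon>': "\<epsilon>' = \<epsilon> / 700000" and l: "3 * d + 2 \<le> l"
    and k: "real d - 1 + 2 * 8 powr (2 / real l) * ((6 * real l) powr (1 + 1 / real l) / \<epsilon>'\<^sup>2) < real k"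
    and wi: "wise_independent u l H"
  define p where "p = (700000 / \<epsilon>)\<^sup>2"
  have "1 \<le> (700000 / \<epsilon>) ^ 2" using \<epsilon> by (intro one_le_power) (simp add: field_simps)
  then have p: "1 \<le> p" by (simp add: p_def)
  have l8: "8 \<le> l" using l d by simp
  have "(6 * real l) powr 1 \<le> (6 * real l) powr (1 + 1 / real l)"
    using l8 by (intro powr_mono) auto
  then have A: "real l \<le> (6 * real l) powr (1 + 1 / real l)" using l8 by simp
  have C: "(1::real) \<le> 2 * 8 powr (2 / real l)"
    using ge_one_powr_ge_zero[of 8 "2 / real l"] by simp
  have "1 * (real l * p) \<le> 2 * 8 powr (2 / real l) * ((6 * real l) powr (1 + 1 / real l) * p)"
    using A C p l8 by (intro mult_mono) auto
  moreover have "(6 * real l) powr (1 + 1 / real l) / \<epsilon>'\<^sup>2 = (6 * real l) powr (1 + 1 / real l) * p"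
    by (simp add: \<epsilon>' p_def power_divide)
  ultimately have lk: "real l * p < real k - 1" using k d by simp
  have "real l * 1 \<le> real l * p" "1 * p \<le> real l * p"
    using p l8 by (intro mult_left_mono mult_right_mono; simp)+
  then have "l < k" "p \<le> real k - 1" using lk by linarith+
  then show "approx_min_wise_independent u d k \<epsilon> H"
    unfolding d p_def using approx_two_min_wise_independent[OF wi l8 _ \<epsilon>] by blast
qed simp

end
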